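(* (1) The inversion set statistic $\mathrm{Inv}$ is weakly shuffle-compatible on parking functions. (2) The linear map on $\mathcal{A}^{\mathrm{PF}}_{\mathrm{Inv}}$ defined by $[\alpha]^{\mathrm{PF}}_{\mathrm{Inv}}\mapsto\mathbf{F}_{\alpha}$, where the representative $\alpha$ is chosen to be the unique permutation of $\mathfrak{S}_{|\alpha|}$ in the class $[\alpha]^{\mathrm{PF}}_{\mathrm{Inv}}$, is an algebra isomorphism from $\mathcal{A}^{\mathrm{PF}}_{\mathrm{Inv}}$ to $\mathrm{FQSym}$.
   Context: All algebras are over $\mathbb{Q}$. A parking function of length $n\ge0$ is a sequence $\alpha=(\alpha_1,\dots,\alpha_n)$ of positive integers whose weakly increasing rearrangement $\alpha'_1\le\dots\le\alpha'_n$ satisfies $\alpha'_i\le i$; $|\alpha|=n$. $\mathrm{PF}_n$ is the set of these and $\mathrm{PF}=\bigcup_{n\ge0}\mathrm{PF}_n$. $\mathfrak{S}_n\subseteq\mathrm{PF}_n$ is the set of permutations of $[n]$ (in one-line notation), $\mathfrak{S}=\bigcup_n\mathfrak{S}_n$. For $\alpha\in\mathrm{PF}_n,\beta\in\mathrm{PF}_m$, the shifted shuffle $\overrightarrow{\mathrm{Sh}}(\alpha,\beta)$ is the set of all interleavings (shuffles) of $\alpha$ and $\beta[n]=(\beta_1+n,\dots,\beta_m+n)$. The inversion set is $\mathrm{Inv}(\alpha)=\{(i,j):i<j,\ \alpha_i>\alpha_j\}$. A statistic $\mathrm{st}$ on $\mathrm{PF}$ is weakly shuffle-compatible on parking functions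 if for all $\alpha,\beta\in\mathrm{PF}$ the multiset $\{\{\mathrm{st}(\gamma):\gamma\in\overrightarrow{\mathrm{Sh}}(\alpha,\beta)\}\}$ is determined by $|\alpha|,|\beta|,\mathrm{st}(\alpha),\mathrm{st}(\beta)$. Let $[\alpha]^{\mathrm{PF}}_{\mathrm{st}}=\{\beta\in\mathrm{PF}:\mathrm{st}(\beta)=\mathrm{st}(\alpha),|\beta|=|\alpha|\}$. $\mathcal{A}^{\mathrm{PF}}_{\mathrm{st}}$ is the algebra with basis these classes and product $[\alpha]^{\mathrm{PF}}_{\mathrm{st}}[\beta]^{\mathrm{PF}}_{\mathrm{st}}=\sum_{\gamma\in\overrightarrow{\mathrm{Sh}}(\alpha,\beta)}[\gamma]^{\mathrm{PF}}_{\mathrm{st}}$. $\mathrm{FQSym}$ is the algebra with basis $\{\mathbf{F}_\pi\}_{\pi\in\mathfrak{S}}$ and product $\mathbf{F}_\tau\mathbf{F}_\theta=\sum_{\pi\in\overrightarrow{\mathrm{Sh}}(\tau,\theta)}\mathbf{F}_\pi$. *)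

theory Defs
  imports
    "HOL-Algebra.Module"
    "HOL-Algebra.Algebraic_Closure_Type"
    "HOL-Library.Poly_Mapping"
    "HOL-Library.Multiset"
    "HOL-Combinatorics.Multiset_Permutations"
begin

text \<open>List positions are 0-based, so the condition on the \<open>i\<close>-th smallest entry
  (1-based) reads \<open>sort \<alpha> ! i \<le> i + 1\<close>.\<close>

definition PF :: "nat list set" where
  "PF = {\<alpha>. (\<forall>x \<in> set \<alpha>. 0 < x) \<and> (\<forall>i < length \<alpha>. sort \<alpha> ! i \<le> i + 1)}"

definition perms :: "nat \<Rightarrow> nat list set" where
  "perms n = permutations_of_set {1..n}"

definition all_perms :: "nat list set" where
  "all_perms = (\<Union>n. perms n)"

definition shifted_shuffle :: "nat list \<Rightarrow> nat list \<Rightarrow> nat list set" where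
  "shifted_shuffle \<alpha> \<beta> = shuffles \<alpha> (map (\<lambda>x. x + length \<alpha>) \<beta>)"

text \<open>Inversions are pairs of 1-based positions.\<close>

definition Inv :: "nat list \<Rightarrow> (nat \<times> nat) set" where
  "Inv \<alpha> = {(i, j). 1 \<le> i \<and> i < j \<and> j \<le> length \<alpha> \<and> \<alpha> ! (i - 1) > \<alpha> ! (j - 1)}"

definition weakly_shuffle_compatible_PF :: "(nat list \<Rightarrow> 's) \<Rightarrow> bool" where
  "weakly_shuffle_compatible_PF st \<longleftrightarrow>
     (\<forall>\<alpha> \<in> PF. \<forall>\<beta> \<in> PF. \<forall>\<alpha>' \<in> PF. \<forall>\<beta>' \<in> PF.
        length \<alpha> = length \<alpha>' \<longrightarrow> length \<beta> = length \<beta>' \<longrightarrow>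
        st \<alpha> = st \<alpha>' \<longrightarrow> st \<beta> = st \<beta>' \<longrightarrow>
        image_mset st (mset_set (shifted_shuffle \<alpha> \<beta>)) =
        image_mset st (mset_set (shifted_shuffle \<alpha>' \<beta>')))"

definition PF_class :: "(nat list \<Rightarrow> 's) \<Rightarrow> nat list \<Rightarrow> nat list set" where
  "PF_class st \<alpha> = {\<beta> \<in> PF. st \<beta> = st \<alpha> \<and> length \<beta> = length \<alpha>}"

text \<open>The vector space with basis \<open>B\<close> consists of the finitely supported functions
  \<open>'b \<Rightarrow>\<^sub>0 rat\<close> with support in \<open>B\<close>; the basis vector of \<open>b\<close> is \<open>bvec b\<close>.\<close>

definition bvec :: "'b \<Rightarrow> 'b \<Rightarrow>\<^sub>0 rat" where
  "bvec b = Poly_Mapping.single b 1"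

definition scale :: "rat \<Rightarrow> ('b \<Rightarrow>\<^sub>0 rat) \<Rightarrow> 'b \<Rightarrow>\<^sub>0 rat" where
  "scale c f = Poly_Mapping.map ((*) c) f"

definition lin_extend :: "('b \<Rightarrow> 'c \<Rightarrow>\<^sub>0 rat) \<Rightarrow> ('b \<Rightarrow>\<^sub>0 rat) \<Rightarrow> 'c \<Rightarrow>\<^sub>0 rat" where
  "lin_extend h f = (\<Sum>b \<in> Poly_Mapping.keys f. scale (Poly_Mapping.lookup f b) (h b))"

text \<open>\<open>p b c\<close> is the product of the basis elements \<open>b\<close> and \<open>c\<close>; the unit is the basis
  element \<open>e\<close>.\<close>

definition basis_algebra ::
  "'b set \<Rightarrow> 'b \<Rightarrow> ('b \<Rightarrow> 'b \<Rightarrow> 'b \<Rightarrow>\<^sub>0 rat) \<Rightarrow> (rat, 'b \<Rightarrow>\<^sub>0 rat) module" where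
  "basis_algebra B e p =
     \<lparr> carrier = {f. Poly_Mapping.keys f \<subseteq> B},
       monoid.mult = (\<lambda>f g. lin_extend (\<lambda>b. lin_extend (\<lambda>c. p b c) g) f),
       one = bvec e, ring.zero = 0, add = (+), module.smult = scale \<rparr>"

text \<open>The library locale \<^locale>\<open>algebra\<close> requires commutative multiplication, which fails
  here.\<close>

locale assoc_algebra = module + ring M +
  assumes smult_mult_left:
      "\<lbrakk>a \<in> carrier R; x \<in> carrier M; y \<in> carrier M\<rbrakk> \<Longrightarrow>
       (a \<odot>\<^bsub>M\<^esub> x) \<otimes>\<^bsub>M\<^esub> y = a \<odot>\<^bsub>M\<^esub> (x \<otimes>\<^bsub>M\<^esub> y)"
    and smult_mult_right:
      "\<lbrakk>a \<in> carrier R; x \<in> carrier M; y \<in> carrier M\<rbrakk> \<Longrightarrow>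
       x \<otimes>\<^bsub>M\<^esub> (a \<odot>\<^bsub>M\<^esub> y) = a \<odot>\<^bsub>M\<^esub> (x \<otimes>\<^bsub>M\<^esub> y)"

definition is_algebra_iso ::
  "('r, 'm) ring_scheme \<Rightarrow> ('r, 'a) module \<Rightarrow> ('r, 'b) module \<Rightarrow> ('a \<Rightarrow> 'b) \<Rightarrow> bool" where
  "is_algebra_iso R A B \<phi> \<longleftrightarrow>
     assoc_algebra R A \<and> assoc_algebra R B \<and> \<phi> \<in> ring_iso A B \<and>
     (\<forall>c \<in> carrier R. \<forall>x \<in> carrier A. \<phi> (c \<odot>\<^bsub>A\<^esub> x) = c \<odot>\<^bsub>B\<^esub> \<phi> x)"

abbreviation rat_field :: "rat ring" where
  "rat_field \<equiv> ring_of_type_algebra"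

text \<open>The product of two classes is computed from arbitrarily chosen representatives; this is
  independent of the choice when \<open>st\<close> is weakly shuffle-compatible.\<close>

definition A_PF :: "(nat list \<Rightarrow> 's) \<Rightarrow> (rat, nat list set \<Rightarrow>\<^sub>0 rat) module" where
  "A_PF st = basis_algebra (PF_class st ` PF) (PF_class st [])
     (\<lambda>C D. \<Sum>\<gamma> \<in> shifted_shuffle (SOME \<alpha>. \<alpha> \<in> C) (SOME \<beta>. \<beta> \<in> D). bvec (PF_class st \<gamma>))"

definition FQSym :: "(rat, nat list \<Rightarrow>\<^sub>0 rat) module" where
  "FQSym = basis_algebra all_perms []
     (\<lambda>\<tau> \<theta>. \<Sum>\<pi> \<in> shifted_shuffle \<tau> \<theta>. bvec \<pi>)"

definition Inv_to_FQSym :: "(nat list set \<Rightarrow>\<^sub>0 rat) \<Rightarrow> nat list \<Rightarrow>\<^sub>0 rat" where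
  "Inv_to_FQSym = lin_extend (\<lambda>C. bvec (THE \<pi>. \<pi> \<in> C \<and> \<pi> \<in> all_perms))"

end

theory Submission
  imports Defs
begin

text \<open>The standardization of a word (the permutation ranking its positions by value, ties broken
  from left to right) depends only on the length and the inversion set, has the same inversion
  set, and fixes permutations; hence it is the unique permutation in the class of the word. It
  maps the shifted shuffles of two parking functions bijectively onto the shifted shuffles of
  their standardizations, because the relative order of two letters from different factors is the
  same on both sides. All claims follow from this bijection.\<close>

section \<open>Linear extension\<close>

text \<open>The obstacle is that a parking function may repeat letters while a shifted shuffle is a
  set, so different interleavings must not be lost or confused. What controls this is that no letter
  of a factor exceeds the length of the factor. The shift then puts the letters of the second factor
  strictly above those of the first, and both factors can be read off from a shuffle by value.
  Associativity and the count of shuffles rest on this bound; the parking condition itself keeps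
  products inside the span of the classes. Equal letters do not form an inversion, and this is what
  dictates breaking ties from left to right. Associativity does not come from the bijection with
  permutations. It is proved for words and then read in each of the two algebras, after the product
  of classes has been freed from its arbitrary representatives.\<close>

lemma lookup_scale [simp]: "Poly_Mapping.lookup (scale c f) k = c * Poly_Mapping.lookup f k"
  by (simp add: scale_def map.rep_eq when_def)

lemma scale_zero_left [simp]: "scale 0 f = 0"
  by (rule poly_mapping_eqI) simp

lemma keys_scale: "Poly_Mapping.keys (scale c f) \<subseteq> Poly_Mapping.keys f"
  by (auto simp: in_keys_iff)

text \<open>Summands outside the support vanish, so vectors with different supports can be compared
  over one common index set.\<close>

lemma lin_extend_eq_sum:
  assumes "finite S" "Poly_Mapping.keys f \<subseteq> S"
  shows "lin_extend h f = (\<Sum>b\<in>S. scale (Poly_Mapping.lookup f b) (h b))"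
  unfolding lin_extend_def
  by (rule sum.mono_neutral_left) (use assms in \<open>auto simp: in_keys_iff\<close>)

lemma lookup_lin_extend:
  "Poly_Mapping.lookup (lin_extend h f) k =
     (\<Sum>b\<in>Poly_Mapping.keys f. Poly_Mapping.lookup f b * Poly_Mapping.lookup (h b) k)"
  by (simp add: lin_extend_def lookup_sum)

lemma lin_extend_cong:
  "(\<And>b. b \<in> Poly_Mapping.keys f \<Longrightarrow> h b = k b) \<Longrightarrow> lin_extend h f = lin_extend k f"
  by (simp add: lin_extend_def)

lemma keys_bvec [simp]: "Poly_Mapping.keys (bvec b) = {b}"
  by (simp add: bvec_def)

lemma lin_extend_bvec [simp]: "lin_extend h (bvec b) = h b"
  by (rule poly_mapping_eqI) (simp add: lookup_lin_extend, simp add: bvec_def)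

lemma lin_extend_bvec_id [simp]: "lin_extend bvec f = f"
proof (rule poly_mapping_eqI)
  fix k
  have "Poly_Mapping.lookup (lin_extend bvec f) k =
      (\<Sum>b\<in>Poly_Mapping.keys f. if b = k then Poly_Mapping.lookup f b else 0)"
    unfolding lookup_lin_extend
    by (rule sum.cong) (auto simp: bvec_def lookup_single when_def)
  also have "\<dots> = Poly_Mapping.lookup f k"
    by (simp add: in_keys_iff)
  finally show "Poly_Mapping.lookup (lin_extend bvec f) k = Poly_Mapping.lookup f k" .
qed

lemma lin_extend_add: "lin_extend h (f + g) = lin_extend h f + lin_extend h g"
proof -
  let ?S = "Poly_Mapping.keys f \<union> Poly_Mapping.keys g"
  have "lin_extend h x = (\<Sum>b\<in>?S. scale (Poly_Mapping.lookup x b) (h b))"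
    if "x \<in> {f, g, f + g}" for x
    by (rule lin_extend_eq_sum) (use that keys_add[of f g] in auto)
  then show ?thesis
    by (intro poly_mapping_eqI)
      (simp add: lookup_add lookup_sum algebra_simps sum.distrib)
qed

lemma lin_extend_scale: "lin_extend h (scale c f) = scale c (lin_extend h f)"
proof -
  have "lin_extend h (scale c f) =
      (\<Sum>b\<in>Poly_Mapping.keys f. scale (Poly_Mapping.lookup (scale c f) b) (h b))"
    by (rule lin_extend_eq_sum[OF finite_keys keys_scale])
  then show ?thesis
    by (intro poly_mapping_eqI)
      (simp add: lookup_sum lookup_lin_extend sum_distrib_left mult.assoc)
qed

lemma lin_extend_zero [simp]: "lin_extend h 0 = 0"
  by (simp add: lin_extend_def)

lemma lin_extend_sum: "lin_extend h (\<Sum>x\<in>A. f x) = (\<Sum>x\<in>A. lin_extend h (f x))"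
  by (induction A rule: infinite_finite_induct) (simp_all add: lin_extend_add)

lemma lin_extend_lin_extend:
  "lin_extend g (lin_extend h f) = lin_extend (\<lambda>b. lin_extend g (h b)) f"
  by (simp add: lin_extend_def[of h f] lin_extend_sum lin_extend_scale)
    (simp add: lin_extend_def[of _ f])

lemma lin_extend_swap:
  "lin_extend (\<lambda>b. lin_extend (\<lambda>c. q b c) g) f = lin_extend (\<lambda>c. lin_extend (\<lambda>b. q b c) f) g"
  by (rule poly_mapping_eqI)
    (simp add: lookup_lin_extend sum_distrib_left mult.left_commute
      sum.swap[of _ "Poly_Mapping.keys f"])

lemma lin_extend_fun_add: "lin_extend (\<lambda>b. h b + k b) f = lin_extend h f + lin_extend k f"
  by (rule poly_mapping_eqI)
    (simp add: lookup_lin_extend lookup_add algebra_simps sum.distrib)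

lemma lin_extend_fun_scale: "lin_extend (\<lambda>b. scale c (h b)) f = scale c (lin_extend h f)"
  by (rule poly_mapping_eqI) (simp add: lookup_lin_extend sum_distrib_left mult.left_commute)

lemma keys_lin_extend:
  assumes "\<And>b. b \<in> Poly_Mapping.keys f \<Longrightarrow> Poly_Mapping.keys (h b) \<subseteq> B"
  shows "Poly_Mapping.keys (lin_extend h f) \<subseteq> B"
proof -
  have "Poly_Mapping.keys (lin_extend h f) \<subseteq>
      (\<Union>b\<in>Poly_Mapping.keys f. Poly_Mapping.keys (scale (Poly_Mapping.lookup f b) (h b)))"
    unfolding lin_extend_def by (rule keys_sum)
  then show ?thesis
    using keys_scale assms by fastforce
qed

lemma keys_sum_bvec: "g ` A \<subseteq> B \<Longrightarrow> Poly_Mapping.keys (\<Sum>x\<in>A. bvec (g x)) \<subseteq> B"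
  using keys_sum[of "\<lambda>x. bvec (g x)" A] by fastforce

section \<open>Algebras given by structure constants\<close>

lemma abelian_group_basis_algebra: "abelian_group (basis_algebra B e p)"
proof (rule abelian_groupI)
  fix x assume "x \<in> carrier (basis_algebra B e p)"
  then show "\<exists>y\<in>carrier (basis_algebra B e p).
      y \<oplus>\<^bsub>basis_algebra B e p\<^esub> x = \<zero>\<^bsub>basis_algebra B e p\<^esub>"
    by (intro bexI[of _ "- x"]) (simp_all add: basis_algebra_def)
qed (use keys_add in \<open>fastforce simp: basis_algebra_def add_ac\<close>)+

text \<open>The product is bilinear by construction, so only closure, unit and associativity remain,
  and these need checking on basis elements alone.\<close>

lemma assoc_algebra_basis_algebra:
  assumes e: "e \<in> B"
    and closed: "\<And>b c. b \<in> B \<Longrightarrow> c \<in> B \<Longrightarrow> Poly_Mapping.keys (p b c) \<subseteq> B"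
    and unit_left: "\<And>b. b \<in> B \<Longrightarrow> p e b = bvec b"
    and unit_right: "\<And>b. b \<in> B \<Longrightarrow> p b e = bvec b"
    and assoc: "\<And>a b c. a \<in> B \<Longrightarrow> b \<in> B \<Longrightarrow> c \<in> B \<Longrightarrow>
      lin_extend (\<lambda>d. p d c) (p a b) = lin_extend (p a) (p b c)"
  shows "assoc_algebra rat_field (basis_algebra B e p)"
proof -
  let ?A = "basis_algebra B e p"
  have mult_closed: "x \<otimes>\<^bsub>?A\<^esub> y \<in> carrier ?A"
    if "x \<in> carrier ?A" "y \<in> carrier ?A" for x y
  proof -
    have "Poly_Mapping.keys (lin_extend (\<lambda>b. lin_extend (\<lambda>c. p b c) y) x) \<subseteq> B"
      by (intro keys_lin_extend closed) (use that in \<open>auto simp: basis_algebra_def\<close>)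
    then show ?thesis by (simp add: basis_algebra_def)
  qed
  have mult_assoc: "(x \<otimes>\<^bsub>?A\<^esub> y) \<otimes>\<^bsub>?A\<^esub> z = x \<otimes>\<^bsub>?A\<^esub> (y \<otimes>\<^bsub>?A\<^esub> z)"
    if "x \<in> carrier ?A" "y \<in> carrier ?A" "z \<in> carrier ?A" for x y z
  proof -
    have "(x \<otimes>\<^bsub>?A\<^esub> y) \<otimes>\<^bsub>?A\<^esub> z =
        lin_extend (\<lambda>b. lin_extend (\<lambda>c. lin_extend (\<lambda>d. lin_extend (p d) z) (p b c)) y) x"
      by (simp add: basis_algebra_def lin_extend_lin_extend)
    \<comment> \<open>Exchanging the two innermost extensions brings \<open>z\<close> outside, so
      that only products of three basis elements are left for \<open>assoc\<close>.\<close>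
    also have "\<dots> =
        lin_extend (\<lambda>b. lin_extend (\<lambda>c. lin_extend (\<lambda>a. lin_extend (\<lambda>d. p d a) (p b c)) z) y) x"
      by (subst lin_extend_swap) (rule refl)
    also have "\<dots> =
        lin_extend (\<lambda>b. lin_extend (\<lambda>c. lin_extend (\<lambda>a. lin_extend (p b) (p c a)) z) y) x"
      by (intro lin_extend_cong assoc) (use that in \<open>auto simp: basis_algebra_def\<close>)
    also have "\<dots> = x \<otimes>\<^bsub>?A\<^esub> (y \<otimes>\<^bsub>?A\<^esub> z)"
      by (simp add: basis_algebra_def lin_extend_lin_extend)
    finally show ?thesis .
  qed
  have one_left: "\<one>\<^bsub>?A\<^esub> \<otimes>\<^bsub>?A\<^esub> x = x" if "x \<in> carrier ?A" for x
  proof -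
    have "\<one>\<^bsub>?A\<^esub> \<otimes>\<^bsub>?A\<^esub> x = lin_extend (p e) x"
      by (simp add: basis_algebra_def)
    also have "\<dots> = lin_extend bvec x"
      by (rule lin_extend_cong) (use that unit_left in \<open>auto simp: basis_algebra_def\<close>)
    finally show ?thesis by simp
  qed
  have one_right: "x \<otimes>\<^bsub>?A\<^esub> \<one>\<^bsub>?A\<^esub> = x" if "x \<in> carrier ?A" for x
  proof -
    have "x \<otimes>\<^bsub>?A\<^esub> \<one>\<^bsub>?A\<^esub> = lin_extend (\<lambda>b. p b e) x"
      by (simp add: basis_algebra_def)
    also have "\<dots> = lin_extend bvec x"
      by (rule lin_extend_cong) (use that unit_right in \<open>auto simp: basis_algebra_def\<close>)
    finally show ?thesis by simp
  qed
  have "monoid ?A"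
    by (rule monoidI)
      (use mult_closed mult_assoc one_left one_right e in \<open>auto simp: basis_algebra_def\<close>)
  then have "ring ?A"
    by (intro ringI abelian_group_basis_algebra)
      (simp_all add: basis_algebra_def lin_extend_add lin_extend_fun_add)
  moreover have "module rat_field ?A"
  proof (rule moduleI)
    show "cring rat_field" by (rule cring_from_type_algebra)
    show "abelian_group ?A" by (rule abelian_group_basis_algebra)
    fix a x assume "x \<in> carrier ?A"
    then show "a \<odot>\<^bsub>?A\<^esub> x \<in> carrier ?A"
      using keys_scale by (fastforce simp: basis_algebra_def)
  qed (auto simp: basis_algebra_def ring_of_type_algebra_def
        lookup_add algebra_simps intro!: poly_mapping_eqI)
  moreover have "assoc_algebra_axioms rat_field ?A"
    by unfold_locales (simp_all add: basis_algebra_def lin_extend_scale lin_extend_fun_scale)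
  ultimately show ?thesis
    by (intro assoc_algebra.intro)
qed

text \<open>A bijection of bases extends to a linear bijection whose inverse is the extension of the
  inverse bijection; by bilinearity, multiplicativity can be tested on structure constants.\<close>

lemma is_algebra_iso_lin_extend:
  assumes "assoc_algebra rat_field (basis_algebra B e p)"
    and "assoc_algebra rat_field (basis_algebra C e' q)"
    and bij: "bij_betw h B C"
    and unit: "h e = e'"
    and hom: "\<And>a b. a \<in> B \<Longrightarrow> b \<in> B \<Longrightarrow> lin_extend (\<lambda>b. bvec (h b)) (p a b) = q (h a) (h b)"
  shows "is_algebra_iso rat_field (basis_algebra B e p) (basis_algebra C e' q)
    (lin_extend (\<lambda>b. bvec (h b)))"
proof -
  let ?A = "basis_algebra B e p" and ?B = "basis_algebra C e' q"
  let ?\<phi> = "lin_extend (\<lambda>b. bvec (h b))" and ?\<psi> = "lin_extend (\<lambda>c. bvec (inv_into B h c))"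
  have hB: "h b \<in> C" if "b \<in> B" for b
    using bij that by (auto simp: bij_betw_def)
  have gC: "inv_into B h c \<in> B" if "c \<in> C" for c
    using bij that by (metis bij_betw_def inv_into_into)
  have \<phi>: "?\<phi> x \<in> carrier ?B" if "x \<in> carrier ?A" for x
    using that hB keys_lin_extend[of x "\<lambda>b. bvec (h b)" C] by (auto simp: basis_algebra_def)
  have \<psi>: "?\<psi> x \<in> carrier ?A" if "x \<in> carrier ?B" for x
    using that gC keys_lin_extend[of x "\<lambda>c. bvec (inv_into B h c)" B]
    by (auto simp: basis_algebra_def)
  have "?\<psi> (?\<phi> x) = x" if "x \<in> carrier ?A" for x
  proof -
    have "?\<psi> (?\<phi> x) = lin_extend bvec x"
      unfolding lin_extend_lin_extend
      by (rule lin_extend_cong)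
        (use that bij in \<open>auto simp: basis_algebra_def bij_betw_inv_into_left\<close>)
    then show ?thesis by simp
  qed
  moreover have "?\<phi> (?\<psi> x) = x" if "x \<in> carrier ?B" for x
  proof -
    have "?\<phi> (?\<psi> x) = lin_extend bvec x"
      unfolding lin_extend_lin_extend
      by (rule lin_extend_cong)
        (use that bij in \<open>auto simp: basis_algebra_def bij_betw_inv_into_right\<close>)
    then show ?thesis by simp
  qed
  ultimately have "bij_betw ?\<phi> (carrier ?A) (carrier ?B)"
    by (intro bij_betw_byWitness[where f' = ?\<psi>]) (use \<phi> \<psi> in auto)
  moreover have "?\<phi> (x \<otimes>\<^bsub>?A\<^esub> y) = ?\<phi> x \<otimes>\<^bsub>?B\<^esub> ?\<phi> y"
    if "x \<in> carrier ?A" "y \<in> carrier ?A" for x y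
  proof -
    have "?\<phi> (x \<otimes>\<^bsub>?A\<^esub> y) = lin_extend (\<lambda>a. lin_extend (\<lambda>b. ?\<phi> (p a b)) y) x"
      by (simp add: basis_algebra_def lin_extend_lin_extend)
    also have "\<dots> = lin_extend (\<lambda>a. lin_extend (\<lambda>b. q (h a) (h b)) y) x"
      by (intro lin_extend_cong hom) (use that in \<open>auto simp: basis_algebra_def\<close>)
    also have "\<dots> = ?\<phi> x \<otimes>\<^bsub>?B\<^esub> ?\<phi> y"
      by (simp add: basis_algebra_def lin_extend_lin_extend)
    finally show ?thesis .
  qed
  ultimately have "?\<phi> \<in> ring_iso ?A ?B"
    using \<phi> unit by (intro ring_iso_memI) (auto simp: basis_algebra_def lin_extend_add)
  then show ?thesis
    using assms(1,2) by (simp add: is_algebra_iso_def) (simp add: basis_algebra_def lin_extend_scale)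
qed

section \<open>Shifted shuffles\<close>

text \<open>Used later with \<open>fst\<close> and \<open>snd\<close>, to project shuffles of words
  of pairs onto shuffles of ordinary words.\<close>

lemma map_shuffles: "map f ` shuffles xs ys = shuffles (map f xs) (map f ys)"
proof (induction xs ys rule: shuffles.induct)
  case (3 x xs y ys)
  have "map f ` shuffles (x # xs) (y # ys) =
      (#) (f x) ` map f ` shuffles xs (y # ys) \<union> (#) (f y) ` map f ` shuffles (x # xs) ys"
    by (simp add: image_Un image_image)
  then show ?case
    by (simp add: 3)
qed auto

text \<open>Here \<open>sorted_wrt\<close> only means that \<open>R\<close> holds from each earlier
  to each later letter. Letters of different factors can occur in either order, hence the two-sided
  condition on \<open>R\<close>.\<close>

lemma sorted_wrt_shuffles:
  assumes "zs \<in> shuffles xs ys" "sorted_wrt R xs" "sorted_wrt R ys"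
    and "\<forall>x\<in>set xs. \<forall>y\<in>set ys. R x y \<and> R y x"
  shows "sorted_wrt R zs"
  using assms
proof (induction xs ys arbitrary: zs rule: shuffles.induct)
  case (3 x xs y ys)
  from "3.prems"(1) consider zs' where "zs = x # zs'" "zs' \<in> shuffles xs (y # ys)"
    | zs' where "zs = y # zs'" "zs' \<in> shuffles (x # xs) ys"
    by auto
  then show ?case
  proof cases
    case 1
    have "sorted_wrt R zs'"
      by (rule "3.IH"(1)[OF 1(2)]) (use "3.prems" in simp_all)
    then show ?thesis
      using 1 "3.prems" set_shuffles[OF 1(2)] by auto
  next
    case 2
    have "sorted_wrt R zs'"
      by (rule "3.IH"(2)[OF 2(2)]) (use "3.prems" in simp_all)
    then show ?thesis
      using 2 "3.prems" set_shuffles[OF 2(2)] by auto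
  qed
qed auto

lemma shifted_shuffle_Nil_left [simp]: "shifted_shuffle [] \<beta> = {\<beta>}"
  by (simp add: shifted_shuffle_def)

lemma shifted_shuffle_Nil_right [simp]: "shifted_shuffle \<alpha> [] = {\<alpha>}"
  by (cases \<alpha>) (simp_all add: shifted_shuffle_def)

lemma finite_shifted_shuffle [simp]: "finite (shifted_shuffle \<alpha> \<beta>)"
  by (simp add: shifted_shuffle_def)

lemma length_shifted_shuffle: "\<gamma> \<in> shifted_shuffle \<alpha> \<beta> \<Longrightarrow> length \<gamma> = length \<alpha> + length \<beta>"
  by (auto simp: shifted_shuffle_def dest: length_shuffles)

lemma set_shifted_shuffle:
  "\<gamma> \<in> shifted_shuffle \<alpha> \<beta> \<Longrightarrow> set \<gamma> = set \<alpha> \<union> (\<lambda>x. x + length \<alpha>) ` set \<beta>"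
  by (auto simp: shifted_shuffle_def dest: set_shuffles)

text \<open>The common home of parking functions and permutations: exactly the bound that makes
  shifting by the length separate two factors by value.\<close>

definition bounded_words :: "nat list set" where
  "bounded_words = {\<alpha>. set \<alpha> \<subseteq> {1..length \<alpha>}}"

lemma bounded_wordsD: "\<alpha> \<in> bounded_words \<Longrightarrow> x \<in> set \<alpha> \<Longrightarrow> 0 < x \<and> x \<le> length \<alpha>"
  by (auto simp: bounded_words_def Suc_le_eq)

lemma shifted_shuffle_bounded_words:
  assumes "\<alpha> \<in> bounded_words" "\<beta> \<in> bounded_words" "\<gamma> \<in> shifted_shuffle \<alpha> \<beta>"
  shows "\<gamma> \<in> bounded_words"
  using assms(1,2) set_shifted_shuffle[OF assms(3)] length_shifted_shuffle[OF assms(3)]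
  by (fastforce simp: bounded_words_def)

text \<open>The letters up to \<open>length \<alpha>\<close> come from \<alpha> and the others from
  \<beta>, so a shuffle is unmixed by filtering at this threshold. In particular it determines its
  factors.\<close>

lemma shifted_shuffle_iff:
  assumes "\<alpha> \<in> bounded_words" "\<beta> \<in> bounded_words"
  shows "\<gamma> \<in> shifted_shuffle \<alpha> \<beta> \<longleftrightarrow>
    filter (\<lambda>x. x \<le> length \<alpha>) \<gamma> = \<alpha> \<and>
    filter (\<lambda>x. length \<alpha> < x) \<gamma> = map (\<lambda>x. x + length \<alpha>) \<beta>"
proof -
  have "List.partition (\<lambda>x. x \<le> length \<alpha>) -` {(\<alpha>, map (\<lambda>x. x + length \<alpha>) \<beta>)} =
      shifted_shuffle \<alpha> \<beta>"
    unfolding shifted_shuffle_def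
    by (rule inv_image_partition) (use assms in \<open>auto dest: bounded_wordsD\<close>)
  then show ?thesis
    by (auto simp: set_eq_iff o_def not_le)
qed

text \<open>Both sides describe the words whose letters in three consecutive ranges of values spell
  \<alpha>, the shifted \<beta> and the shifted \<gamma>; this is \<open>?P\<close>.\<close>

lemma shifted_shuffle_assoc:
  assumes \<alpha>: "\<alpha> \<in> bounded_words" and \<beta>: "\<beta> \<in> bounded_words" and \<gamma>: "\<gamma> \<in> bounded_words"
  shows "(\<Union>\<pi>\<in>shifted_shuffle \<alpha> \<beta>. shifted_shuffle \<pi> \<gamma>) =
    (\<Union>\<pi>\<in>shifted_shuffle \<beta> \<gamma>. shifted_shuffle \<alpha> \<pi>)"
proof (rule Set.set_eqI)
  fix \<sigma>
  let ?n = "length \<alpha>" and ?m = "length \<beta>"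
  let ?P = "filter (\<lambda>x. x \<le> ?n) \<sigma> = \<alpha> \<and>
    filter (\<lambda>x. ?n < x \<and> x \<le> ?n + ?m) \<sigma> = map (\<lambda>x. x + ?n) \<beta> \<and>
    filter (\<lambda>x. ?n + ?m < x) \<sigma> = map (\<lambda>x. x + (?n + ?m)) \<gamma>"
  \<comment> \<open>Every such \<pi> has length \<open>?n + ?m\<close>, so the threshold in front of
    \<gamma> does not depend on \<pi>.\<close>
  have "\<sigma> \<in> (\<Union>\<pi>\<in>shifted_shuffle \<alpha> \<beta>. shifted_shuffle \<pi> \<gamma>) \<longleftrightarrow>
      (\<exists>\<pi>. \<pi> \<in> shifted_shuffle \<alpha> \<beta> \<and> filter (\<lambda>x. x \<le> ?n + ?m) \<sigma> = \<pi> \<and>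
        filter (\<lambda>x. ?n + ?m < x) \<sigma> = map (\<lambda>x. x + (?n + ?m)) \<gamma>)"
    using shifted_shuffle_iff[OF shifted_shuffle_bounded_words[OF \<alpha> \<beta>] \<gamma>]
    by (auto simp: length_shifted_shuffle)
  also have "\<dots> \<longleftrightarrow> filter (\<lambda>x. x \<le> ?n) (filter (\<lambda>x. x \<le> ?n + ?m) \<sigma>) = \<alpha> \<and>
      filter (\<lambda>x. ?n < x) (filter (\<lambda>x. x \<le> ?n + ?m) \<sigma>) = map (\<lambda>x. x + ?n) \<beta> \<and>
      filter (\<lambda>x. ?n + ?m < x) \<sigma> = map (\<lambda>x. x + (?n + ?m)) \<gamma>"
    by (simp add: shifted_shuffle_iff[OF \<alpha> \<beta>] del: filter_filter)
  also have "\<dots> \<longleftrightarrow> ?P"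
  proof -
    have "(\<lambda>x. x \<le> ?n + ?m \<and> x \<le> ?n) = (\<lambda>x. x \<le> ?n)"
         "(\<lambda>x. x \<le> ?n + ?m \<and> ?n < x) = (\<lambda>x. ?n < x \<and> x \<le> ?n + ?m)"
      by (auto simp: fun_eq_iff)
    then show ?thesis by simp
  qed
  finally have left: "\<sigma> \<in> (\<Union>\<pi>\<in>shifted_shuffle \<alpha> \<beta>. shifted_shuffle \<pi> \<gamma>) \<longleftrightarrow> ?P" .
  have shift: "map (\<lambda>x. x + ?n) \<pi> = map (\<lambda>x. x + ?n) \<rho> \<longleftrightarrow> \<pi> = \<rho>" for \<pi> \<rho>
    by (rule inj_map_eq_map) (simp add: inj_def)
  \<comment> \<open>Membership is phrased through the shifted \<pi>, because that is the word which
    filtering \<sigma> produces.\<close>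
  have \<pi>_iff: "\<pi> \<in> shifted_shuffle \<beta> \<gamma> \<longleftrightarrow>
      filter (\<lambda>x. x \<le> ?n + ?m) (map (\<lambda>x. x + ?n) \<pi>) = map (\<lambda>x. x + ?n) \<beta> \<and>
      filter (\<lambda>x. ?n + ?m < x) (map (\<lambda>x. x + ?n) \<pi>) = map (\<lambda>x. x + (?n + ?m)) \<gamma>" for \<pi>
  proof -
    have "filter (\<lambda>x. x \<le> ?n + ?m) (map (\<lambda>x. x + ?n) \<pi>) =
        map (\<lambda>x. x + ?n) (filter (\<lambda>x. x \<le> ?m) \<pi>)"
         "filter (\<lambda>x. ?n + ?m < x) (map (\<lambda>x. x + ?n) \<pi>) =
        map (\<lambda>x. x + ?n) (filter (\<lambda>x. ?m < x) \<pi>)"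
         "map (\<lambda>x. x + (?n + ?m)) \<gamma> = map (\<lambda>x. x + ?n) (map (\<lambda>x. x + ?m) \<gamma>)"
      by (simp_all add: filter_map o_def add.commute add.left_commute)
    then show ?thesis
      by (simp only: shifted_shuffle_iff[OF \<beta> \<gamma>] shift)
  qed
  have "\<sigma> \<in> (\<Union>\<pi>\<in>shifted_shuffle \<beta> \<gamma>. shifted_shuffle \<alpha> \<pi>) \<longleftrightarrow>
      (\<exists>\<pi>. \<pi> \<in> shifted_shuffle \<beta> \<gamma> \<and> filter (\<lambda>x. x \<le> ?n) \<sigma> = \<alpha> \<and>
        filter (\<lambda>x. ?n < x) \<sigma> = map (\<lambda>x. x + ?n) \<pi>)"
    using shifted_shuffle_iff[OF \<alpha> shifted_shuffle_bounded_words[OF \<beta> \<gamma>]] by auto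
  also have "\<dots> \<longleftrightarrow> filter (\<lambda>x. x \<le> ?n) \<sigma> = \<alpha> \<and>
      filter (\<lambda>x. x \<le> ?n + ?m) (filter (\<lambda>x. ?n < x) \<sigma>) = map (\<lambda>x. x + ?n) \<beta> \<and>
      filter (\<lambda>x. ?n + ?m < x) (filter (\<lambda>x. ?n < x) \<sigma>) = map (\<lambda>x. x + (?n + ?m)) \<gamma>"
  proof -
    \<comment> \<open>The witness for \<pi> is obtained by subtracting \<open>?n\<close> from the
      large letters of \<sigma>; truncated subtraction is harmless as they all exceed
      \<open>?n\<close>.\<close>
    have "filter (\<lambda>x. ?n < x) \<sigma> =
        map (\<lambda>x. x + ?n) (map (\<lambda>x. x - ?n) (filter (\<lambda>x. ?n < x) \<sigma>))"
      unfolding map_map by (rule map_idI[symmetric]) auto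
    then show ?thesis
      unfolding \<pi>_iff by metis
  qed
  also have "\<dots> \<longleftrightarrow> ?P"
  proof -
    have "(\<lambda>x. ?n < x \<and> ?n + ?m < x) = (\<lambda>x. ?n + ?m < x)"
      by (auto simp: fun_eq_iff)
    then show ?thesis by simp
  qed
  finally show "\<sigma> \<in> (\<Union>\<pi>\<in>shifted_shuffle \<alpha> \<beta>. shifted_shuffle \<pi> \<gamma>) \<longleftrightarrow>
      \<sigma> \<in> (\<Union>\<pi>\<in>shifted_shuffle \<beta> \<gamma>. shifted_shuffle \<alpha> \<pi>)"
    using left by simp
qed

text \<open>The intermediate word \<pi> can be recovered from \<sigma>, so the unions in
  \<open>shifted_shuffle_assoc\<close> are disjoint and the identity of sets carries over to sums
  without multiplicities.\<close>

lemma sum_shifted_shuffle_assoc: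
  fixes f :: "nat list \<Rightarrow> 'a::comm_monoid_add"
  assumes \<alpha>: "\<alpha> \<in> bounded_words" and \<beta>: "\<beta> \<in> bounded_words" and \<gamma>: "\<gamma> \<in> bounded_words"
  shows "(\<Sum>\<pi>\<in>shifted_shuffle \<alpha> \<beta>. \<Sum>\<sigma>\<in>shifted_shuffle \<pi> \<gamma>. f \<sigma>) =
    (\<Sum>\<pi>\<in>shifted_shuffle \<beta> \<gamma>. \<Sum>\<sigma>\<in>shifted_shuffle \<alpha> \<pi>. f \<sigma>)"
proof -
  have "shifted_shuffle \<pi> \<gamma> \<inter> shifted_shuffle \<pi>' \<gamma> = {}"
    if "\<pi> \<in> shifted_shuffle \<alpha> \<beta>" "\<pi>' \<in> shifted_shuffle \<alpha> \<beta>" "\<pi> \<noteq> \<pi>'" for \<pi> \<pi>'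
    using that shifted_shuffle_iff[OF shifted_shuffle_bounded_words[OF \<alpha> \<beta>] \<gamma>]
    by (auto simp: length_shifted_shuffle)
  then have "(\<Sum>\<pi>\<in>shifted_shuffle \<alpha> \<beta>. \<Sum>\<sigma>\<in>shifted_shuffle \<pi> \<gamma>. f \<sigma>) =
      sum f (\<Union>\<pi>\<in>shifted_shuffle \<alpha> \<beta>. shifted_shuffle \<pi> \<gamma>)"
    by (subst sum.UNION_disjoint) auto
  moreover have "shifted_shuffle \<alpha> \<pi> \<inter> shifted_shuffle \<alpha> \<pi>' = {}"
    if "\<pi> \<in> shifted_shuffle \<beta> \<gamma>" "\<pi>' \<in> shifted_shuffle \<beta> \<gamma>" "\<pi> \<noteq> \<pi>'" for \<pi> \<pi>'
  proof -
    have "inj (map (\<lambda>x. x + length \<alpha>))"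
      by (simp add: inj_def)
    then show ?thesis
      using that shifted_shuffle_iff[OF \<alpha> shifted_shuffle_bounded_words[OF \<beta> \<gamma>]]
      by (auto dest: injD)
  qed
  then have "(\<Sum>\<pi>\<in>shifted_shuffle \<beta> \<gamma>. \<Sum>\<sigma>\<in>shifted_shuffle \<alpha> \<pi>. f \<sigma>) =
      sum f (\<Union>\<pi>\<in>shifted_shuffle \<beta> \<gamma>. shifted_shuffle \<alpha> \<pi>)"
    by (subst sum.UNION_disjoint) auto
  ultimately show ?thesis
    by (simp add: shifted_shuffle_assoc[OF \<alpha> \<beta> \<gamma>])
qed

section \<open>Parking functions and permutations\<close>

text \<open>Counting small letters replaces sorting; the counts are additive on shuffles.\<close>

lemma sorted_nth_le_iff:
  fixes s :: "nat list"
  assumes "sorted s"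
  shows "(\<forall>i<length s. s ! i \<le> i + 1) \<longleftrightarrow>
    (\<forall>k\<le>length s. k \<le> length (filter (\<lambda>x. x \<le> k) s))"
proof (intro iffI allI impI)
  fix k assume s: "\<forall>i<length s. s ! i \<le> i + 1" and k: "k \<le> length s"
  have "x \<le> k" if "x \<in> set (take k s)" for x
  proof -
    from that k obtain i where "i < k" "x = s ! i"
      by (auto simp: in_set_conv_nth)
    then show ?thesis
      using s[rule_format, of i] k by simp
  qed
  then have "filter (\<lambda>x. x \<le> k) (take k s) = take k s"
    by (simp add: filter_id_conv)
  then have "length (filter (\<lambda>x. x \<le> k) (take k s @ drop k s)) \<ge> k"
    using k by (simp only: filter_append length_append) simp
  then show "k \<le> length (filter (\<lambda>x. x \<le> k) s)"
    by simp
next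
  fix i assume *: "\<forall>k\<le>length s. k \<le> length (filter (\<lambda>x. x \<le> k) s)" and i: "i < length s"
  show "s ! i \<le> i + 1"
  proof (rule ccontr)
    assume "\<not> s ! i \<le> i + 1"
    \<comment> \<open>If \<open>s ! i\<close> is too large, so are all later entries. At most
      \<open>i\<close> entries are then bounded by \<open>i + 1\<close>, against the count for
      \<open>k = i + 1\<close>.\<close>
    have "{j. j < length s \<and> s ! j \<le> i + 1} \<subseteq> {..<i}"
    proof
      fix j assume j: "j \<in> {j. j < length s \<and> s ! j \<le> i + 1}"
      show "j \<in> {..<i}"
      proof (rule ccontr)
        assume "j \<notin> {..<i}"
        then have "s ! i \<le> s ! j"
          using j assms by (auto intro: sorted_nth_mono)
        then show False
          using j \<open>\<not> s ! i \<le> i + 1\<close> by auto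
      qed
    qed
    then have "card {j. j < length s \<and> s ! j \<le> i + 1} \<le> card {..<i}"
      by (intro card_mono) auto
    then have "length (filter (\<lambda>x. x \<le> i + 1) s) \<le> i"
      by (simp add: length_filter_conv_card)
    moreover have "i + 1 \<le> length (filter (\<lambda>x. x \<le> i + 1) s)"
      using * i by (metis Suc_eq_plus1 Suc_leI)
    ultimately show False by simp
  qed
qed

lemma PF_iff:
  "\<alpha> \<in> PF \<longleftrightarrow> (\<forall>x\<in>set \<alpha>. 0 < x) \<and>
     (\<forall>k\<le>length \<alpha>. k \<le> length (filter (\<lambda>x. x \<le> k) \<alpha>))"
proof -
  have "length (filter P (sort \<alpha>)) = length (filter P \<alpha>)" for P
    by (metis filter_sort length_sort)
  then show ?thesis
    using sorted_nth_le_iff[of "sort \<alpha>"] by (simp add: PF_def)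
qed

lemma PF_subset_bounded_words: "PF \<subseteq> bounded_words"
proof
  fix \<alpha> assume \<alpha>: "\<alpha> \<in> PF"
  \<comment> \<open>The counting criterion at the largest threshold leaves no letter
    uncounted.\<close>
  then have "length (filter (\<lambda>x. x \<le> length \<alpha>) \<alpha>) = length \<alpha>"
    by (simp add: PF_iff le_antisym)
  then have "\<forall>x\<in>set \<alpha>. x \<le> length \<alpha>"
    by (metis filter_True length_filter_less less_irrefl)
  then show "\<alpha> \<in> bounded_words"
    using \<alpha> by (auto simp: bounded_words_def PF_iff Suc_le_eq)
qed

text \<open>For a threshold up to \<open>length \<alpha>\<close>, the letters of \<alpha> already
  suffice. Beyond it, all of \<alpha> is counted and \<beta> supplies the remaining
  \<open>k - length \<alpha>\<close> letters.\<close>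

lemma shifted_shuffle_PF:
  assumes \<alpha>: "\<alpha> \<in> PF" and \<beta>: "\<beta> \<in> PF" and \<gamma>: "\<gamma> \<in> shifted_shuffle \<alpha> \<beta>"
  shows "\<gamma> \<in> PF"
proof -
  have "k \<le> length (filter (\<lambda>x. x \<le> k) \<gamma>)" if "k \<le> length \<gamma>" for k
  proof -
    have "filter (\<lambda>x. x \<le> k) \<gamma> \<in> shuffles (filter (\<lambda>x. x \<le> k) \<alpha>)
        (filter (\<lambda>x. x \<le> k) (map (\<lambda>x. x + length \<alpha>) \<beta>))"
      using \<gamma> by (auto simp: shifted_shuffle_def filter_shuffles[symmetric])
    then have len: "length (filter (\<lambda>x. x \<le> k) \<gamma>) =
        length (filter (\<lambda>x. x \<le> k) \<alpha>) + length (filter (\<lambda>x. x + length \<alpha> \<le> k) \<beta>)"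
      by (auto simp: filter_map o_def dest: length_shuffles)
    show ?thesis
    proof (cases "k \<le> length \<alpha>")
      case True
      then show ?thesis using \<alpha> len by (fastforce simp: PF_iff)
    next
      case False
      then have "(\<lambda>x. x + length \<alpha> \<le> k) = (\<lambda>x. x \<le> k - length \<alpha>)"
        by (auto simp: fun_eq_iff)
      moreover have "k - length \<alpha> \<le> length (filter (\<lambda>x. x \<le> k - length \<alpha>) \<beta>)"
        using \<beta> that length_shifted_shuffle[OF \<gamma>] by (simp add: PF_iff)
      moreover have "filter (\<lambda>x. x \<le> k) \<alpha> = \<alpha>"
        using False \<alpha> PF_subset_bounded_words by (fastforce simp: filter_id_conv dest: bounded_wordsD)
      ultimately show ?thesis using len False by simp
    qed
  qed
  then show ?thesis
    using \<alpha> \<beta> set_shifted_shuffle[OF \<gamma>] by (auto simp: PF_iff)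
qed

section \<open>Permutations among parking functions\<close>

lemma perms_iff: "\<pi> \<in> perms n \<longleftrightarrow> distinct \<pi> \<and> set \<pi> = {1..n}"
  by (auto simp: perms_def permutations_of_set_def)

lemma length_perms: "\<pi> \<in> perms n \<Longrightarrow> length \<pi> = n"
  by (metis perms_iff card_atLeastAtMost diff_Suc_1 distinct_card)

lemma all_perms_iff: "\<pi> \<in> all_perms \<longleftrightarrow> \<pi> \<in> perms (length \<pi>)"
  using length_perms by (auto simp: all_perms_def)

text \<open>A permutation has exactly \<open>k\<close> letters bounded by \<open>k\<close>, so it
  meets the counting criterion with equality.\<close>

lemma all_perms_subset_PF: "all_perms \<subseteq> PF"
proof
  fix \<pi> assume "\<pi> \<in> all_perms"
  then have \<pi>: "distinct \<pi>" "set \<pi> = {1..length \<pi>}"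
    by (simp_all add: all_perms_iff perms_iff)
  have "k \<le> length (filter (\<lambda>x. x \<le> k) \<pi>)" if "k \<le> length \<pi>" for k
  proof -
    have "length (filter (\<lambda>x. x \<le> k) \<pi>) = card {x \<in> set \<pi>. x \<le> k}"
      using \<pi>(1) by (metis distinct_card distinct_filter set_filter)
    also have "{x \<in> set \<pi>. x \<le> k} = {1..k}"
      using that by (auto simp: \<pi>(2))
    finally show ?thesis by simp
  qed
  then show "\<pi> \<in> PF"
    using \<pi>(2) by (auto simp: PF_iff)
qed

lemma shifted_shuffle_all_perms:
  assumes "\<tau> \<in> all_perms" "\<theta> \<in> all_perms" and \<gamma>: "\<gamma> \<in> shifted_shuffle \<tau> \<theta>"
  shows "\<gamma> \<in> all_perms"
proof -
  have \<tau>: "distinct \<tau>" "set \<tau> = {1..length \<tau>}" and \<theta>: "distinct \<theta>" "set \<theta> = {1..length \<theta>}"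
    using assms by (simp_all add: all_perms_iff perms_iff)
  have "(\<lambda>x. x + length \<tau>) ` {1..length \<theta>} = {length \<tau> + 1..length \<tau> + length \<theta>}"
    by (simp add: add.commute image_add_atLeastAtMost)
  then have set: "set \<gamma> = {1..length \<gamma>}"
    using set_shifted_shuffle[OF \<gamma>] length_shifted_shuffle[OF \<gamma>] \<tau>(2) \<theta>(2) by auto
  \<comment> \<open>The word has as many different letters as positions.\<close>
  moreover have "distinct \<gamma>"
    using set by (intro card_distinct) simp
  ultimately show ?thesis
    by (simp add: all_perms_iff perms_iff)
qed

section \<open>Standardization\<close>

definition std_le :: "nat list \<Rightarrow> nat \<Rightarrow> nat \<Rightarrow> bool" where
  "std_le \<alpha> j i \<longleftrightarrow> \<alpha> ! j < \<alpha> ! i \<or> \<alpha> ! j = \<alpha> ! i \<and> j \<le> i"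

text \<open>A position is counted among its own predecessors, so ranks start at 1.\<close>

definition std_rank :: "nat list \<Rightarrow> nat \<Rightarrow> nat" where
  "std_rank \<alpha> i = card {j. j < length \<alpha> \<and> std_le \<alpha> j i}"

definition standardize :: "nat list \<Rightarrow> nat list" where
  "standardize \<alpha> = map (std_rank \<alpha>) [0..<length \<alpha>]"

lemma length_standardize [simp]: "length (standardize \<alpha>) = length \<alpha>"
  by (simp add: standardize_def)

text \<open>\<open>std_le\<close> orders positions linearly and ranks are sizes of its initial
  segments; the segment of \<open>i\<close> properly contains that of \<open>k\<close> since
  \<open>i\<close> itself is missing from the latter.\<close>

lemma std_rank_less:
  assumes "i < length \<alpha>" "\<not> std_le \<alpha> i k"
  shows "std_rank \<alpha> k < std_rank \<alpha> i"
  unfolding std_rank_def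
proof (rule psubset_card_mono)
  have "i \<in> {j. j < length \<alpha> \<and> std_le \<alpha> j i}" "i \<notin> {j. j < length \<alpha> \<and> std_le \<alpha> j k}"
    using assms by (auto simp: std_le_def)
  moreover have "{j. j < length \<alpha> \<and> std_le \<alpha> j k} \<subseteq> {j. j < length \<alpha> \<and> std_le \<alpha> j i}"
    using assms(2) by (auto simp: std_le_def)
  ultimately show "{j. j < length \<alpha> \<and> std_le \<alpha> j k} \<subset> {j. j < length \<alpha> \<and> std_le \<alpha> j i}"
    by blast
qed simp

lemma std_rank_less_iff:
  assumes "i < length \<alpha>" "k < length \<alpha>"
  shows "std_rank \<alpha> k < std_rank \<alpha> i \<longleftrightarrow> \<not> std_le \<alpha> i k"
proof
  assume "std_rank \<alpha> k < std_rank \<alpha> i"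
  then show "\<not> std_le \<alpha> i k"
    using std_rank_less[OF assms(2), of i] by (cases "i = k") (auto simp: std_le_def)
qed (rule std_rank_less[OF assms(1)])

lemma standardize_perms: "standardize \<alpha> \<in> perms (length \<alpha>)"
proof -
  let ?n = "length \<alpha>"
  have "inj_on (std_rank \<alpha>) {..<?n}"
  proof (rule inj_onI)
    fix i k assume "i \<in> {..<?n}" "k \<in> {..<?n}" "std_rank \<alpha> i = std_rank \<alpha> k"
    then have "std_le \<alpha> i k" "std_le \<alpha> k i"
      using std_rank_less[of i \<alpha> k] std_rank_less[of k \<alpha> i] by auto
    then show "i = k"
      by (auto simp: std_le_def)
  qed
  moreover have "std_rank \<alpha> ` {..<?n} \<subseteq> {1..?n}"
  proof
    fix r assume "r \<in> std_rank \<alpha> ` {..<?n}"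
    then obtain i where i: "i < ?n" "r = std_rank \<alpha> i" by auto
    have "r \<le> card {..<?n}"
      unfolding i(2) std_rank_def by (rule card_mono) auto
    moreover have "i \<in> {j. j < ?n \<and> std_le \<alpha> j i}"
      using i(1) by (simp add: std_le_def)
    then have "r > 0"
      unfolding i(2) std_rank_def by (auto simp: card_gt_0_iff)
    ultimately show "r \<in> {1..?n}" by simp
  qed
  \<comment> \<open>An injection from \<open>?n\<close> positions into \<open>?n\<close> values is
    onto.\<close>
  ultimately have "std_rank \<alpha> ` {..<?n} = {1..?n}"
    by (intro card_subset_eq) (simp_all add: card_image)
  with \<open>inj_on (std_rank \<alpha>) {..<?n}\<close>
  have "distinct (standardize \<alpha>)" "set (standardize \<alpha>) = {1..?n}"
    by (simp_all add: standardize_def distinct_map atLeast0LessThan)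
  then show ?thesis by (simp add: perms_iff)
qed

lemma standardize_all_perms: "standardize \<alpha> \<in> all_perms"
  using standardize_perms by (simp add: all_perms_iff)

section \<open>Standardization and inversion sets\<close>

lemma Suc_in_Inv_iff: "(Suc i, Suc j) \<in> Inv \<alpha> \<longleftrightarrow> i < j \<and> j < length \<alpha> \<and> \<alpha> ! i > \<alpha> ! j"
  by (auto simp: Inv_def)

lemma Inv_eq_iff:
  assumes "length \<alpha> = length \<beta>"
  shows "Inv \<alpha> = Inv \<beta> \<longleftrightarrow>
    (\<forall>i j. i < j \<longrightarrow> j < length \<alpha> \<longrightarrow> (\<alpha> ! i > \<alpha> ! j \<longleftrightarrow> \<beta> ! i > \<beta> ! j))"
proof
  assume "Inv \<alpha> = Inv \<beta>"
  then show "\<forall>i j. i < j \<longrightarrow> j < length \<alpha> \<longrightarrow> (\<alpha> ! i > \<alpha> ! j \<longleftrightarrow> \<beta> ! i > \<beta> ! j)"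
    using Suc_in_Inv_iff[of _ _ \<alpha>] Suc_in_Inv_iff[of _ _ \<beta>] assms by metis
next
  assume *: "\<forall>i j. i < j \<longrightarrow> j < length \<alpha> \<longrightarrow> (\<alpha> ! i > \<alpha> ! j \<longleftrightarrow> \<beta> ! i > \<beta> ! j)"
  have "\<alpha> ! (i - 1) > \<alpha> ! (j - 1) \<longleftrightarrow> \<beta> ! (i - 1) > \<beta> ! (j - 1)"
    if "1 \<le> i" "i < j" "j \<le> length \<alpha>" for i j
    using *[rule_format, of "i - 1" "j - 1"] that by simp
  then show "Inv \<alpha> = Inv \<beta>"
    using assms by (auto simp: Inv_def)
qed

text \<open>For \<open>i < j\<close> a tie ranks \<open>i\<close> first, so \<open>j\<close> is
  ranked below \<open>i\<close> exactly when \<open>\<alpha> ! i > \<alpha> ! j\<close>.\<close>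

lemma Inv_standardize [simp]: "Inv (standardize \<alpha>) = Inv \<alpha>"
proof -
  have "\<alpha> ! i > \<alpha> ! j \<longleftrightarrow> standardize \<alpha> ! i > standardize \<alpha> ! j"
    if "i < j" "j < length \<alpha>" for i j
    using that std_rank_less_iff[of i \<alpha> j] by (auto simp: standardize_def std_le_def)
  then show ?thesis
    by (simp add: Inv_eq_iff)
qed

text \<open>How \<open>std_le\<close> orders two positions is decided by whether they form an
  inversion, so the ranks depend on nothing else.\<close>

lemma standardize_cong:
  assumes "length \<alpha> = length \<beta>" "Inv \<alpha> = Inv \<beta>"
  shows "standardize \<alpha> = standardize \<beta>"
proof -
  have "std_le \<alpha> j i \<longleftrightarrow> std_le \<beta> j i" if "i < length \<beta>" "j < length \<beta>" for i j
  proof -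
    have "i < j \<Longrightarrow> \<alpha> ! i > \<alpha> ! j \<longleftrightarrow> \<beta> ! i > \<beta> ! j" "j < i \<Longrightarrow> \<alpha> ! j > \<alpha> ! i \<longleftrightarrow> \<beta> ! j > \<beta> ! i"
      using assms that by (simp_all add: Inv_eq_iff)
    then show ?thesis
      by (cases i j rule: linorder_cases) (auto simp: std_le_def)
  qed
  then have "std_rank \<alpha> i = std_rank \<beta> i" if "i < length \<beta>" for i
    unfolding std_rank_def using that assms(1) by (intro arg_cong[where f = card]) auto
  then show ?thesis
    using assms(1) by (simp add: standardize_def)
qed

lemma standardize_perm:
  assumes "\<pi> \<in> all_perms"
  shows "standardize \<pi> = \<pi>"
proof (rule nth_equalityI)
  have \<pi>: "distinct \<pi>" "set \<pi> = {1..length \<pi>}"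
    using assms by (simp_all add: all_perms_iff perms_iff)
  fix i assume "i < length (standardize \<pi>)"
  then have i: "i < length \<pi>" by simp
  have inj: "inj_on ((!) \<pi>) {j. j < length \<pi> \<and> std_le \<pi> j i}"
    using \<pi>(1) by (auto simp: inj_on_def nth_eq_iff_index_eq)
  have "\<pi> ! i \<le> length \<pi>"
    using i \<pi>(2) nth_mem[OF i] by auto
  \<comment> \<open>Without ties, the rank of a position counts the letters up to
    \<open>\<pi> ! i\<close>. In a permutation these are all the numbers from 1 to
    \<open>\<pi> ! i\<close>.\<close>
  then have "(!) \<pi> ` {j. j < length \<pi> \<and> std_le \<pi> j i} = {1..\<pi> ! i}"
  proof (intro subset_antisym subsetI)
    fix x assume "x \<in> (!) \<pi> ` {j. j < length \<pi> \<and> std_le \<pi> j i}"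
    then show "x \<in> {1..\<pi> ! i}"
      using \<pi>(2) by (fastforce simp: std_le_def)
  next
    fix x assume "x \<in> {1..\<pi> ! i}"
    with \<open>\<pi> ! i \<le> length \<pi>\<close> have "x \<in> set \<pi>" "x \<le> \<pi> ! i"
      unfolding \<pi>(2) by auto
    then obtain j where j: "j < length \<pi>" "\<pi> ! j = x" by (auto simp: in_set_conv_nth)
    then have "std_le \<pi> j i"
      using \<open>x \<le> \<pi> ! i\<close> i \<pi>(1) by (auto simp: std_le_def nth_eq_iff_index_eq order_le_less)
    then show "x \<in> (!) \<pi> ` {j. j < length \<pi> \<and> std_le \<pi> j i}"
      using j by auto
  qed
  then have "std_rank \<pi> i = \<pi> ! i"
    unfolding std_rank_def using card_image[OF inj] by simp
  then show "standardize \<pi> ! i = \<pi> ! i"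
    using i by (simp add: standardize_def)
qed simp

section \<open>Transfer of shuffles between words with equal inversion sets\<close>

lemma Inv_eq_iff_sorted_wrt_zip:
  assumes "length \<alpha> = length \<beta>"
  shows "Inv \<alpha> = Inv \<beta> \<longleftrightarrow>
    sorted_wrt (\<lambda>p q. fst p > fst q \<longleftrightarrow> snd p > snd q) (zip \<alpha> \<beta>)"
  using assms by (auto simp: Inv_eq_iff sorted_wrt_iff_nth_less)

lemma shifted_shuffle_transfer:
  assumes \<alpha>: "\<alpha> \<in> bounded_words" "\<alpha>' \<in> bounded_words" "length \<alpha> = length \<alpha>'" "Inv \<alpha> = Inv \<alpha>'"
    and \<beta>: "\<beta> \<in> bounded_words" "\<beta>' \<in> bounded_words" "length \<beta> = length \<beta>'" "Inv \<beta> = Inv \<beta>'"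
    and \<gamma>: "\<gamma> \<in> shifted_shuffle \<alpha> \<beta>"
  obtains \<gamma>' where "\<gamma>' \<in> shifted_shuffle \<alpha>' \<beta>'" "length \<gamma>' = length \<gamma>" "Inv \<gamma>' = Inv \<gamma>"
proof -
  \<comment> \<open>Shuffle the pairs of corresponding letters and project to either component.\<close>
  let ?s = "map (\<lambda>x. x + length \<alpha>)"
  let ?R = "\<lambda>p q :: nat \<times> nat. fst p > fst q \<longleftrightarrow> snd p > snd q"
  have "map fst ` shuffles (zip \<alpha> \<alpha>') (zip (?s \<beta>) (?s \<beta>')) = shifted_shuffle \<alpha> \<beta>"
    using \<alpha>(3) \<beta>(3) by (simp add: map_shuffles shifted_shuffle_def)
  with \<gamma> obtain Z where Z: "Z \<in> shuffles (zip \<alpha> \<alpha>') (zip (?s \<beta>) (?s \<beta>'))" "\<gamma> = map fst Z"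
    by blast
  \<comment> \<open>\<open>?R\<close> says that two pairs of letters are inverted in both
    projections or in neither. As a condition on pairs of positions it is inherited by
    shuffles.\<close>
  have "sorted_wrt ?R Z"
  proof (rule sorted_wrt_shuffles[OF Z(1)])
    show "sorted_wrt ?R (zip \<alpha> \<alpha>')"
      using \<alpha>(3,4) by (simp flip: Inv_eq_iff_sorted_wrt_zip)
    have "sorted_wrt ?R (zip \<beta> \<beta>')"
      using \<beta>(3,4) by (simp flip: Inv_eq_iff_sorted_wrt_zip)
    then show "sorted_wrt ?R (zip (?s \<beta>) (?s \<beta>'))"
      using \<beta>(3) by (auto simp: sorted_wrt_iff_nth_less)
    show "\<forall>x\<in>set (zip \<alpha> \<alpha>'). \<forall>y\<in>set (zip (?s \<beta>) (?s \<beta>')). ?R x y \<and> ?R y x"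
    proof (intro ballI)
      fix x y assume "x \<in> set (zip \<alpha> \<alpha>')" "y \<in> set (zip (?s \<beta>) (?s \<beta>'))"
      then have "fst x \<in> set \<alpha>" "snd x \<in> set \<alpha>'" "fst y \<in> set (?s \<beta>)" "snd y \<in> set (?s \<beta>')"
        by (metis prod.collapse set_zip_leftD set_zip_rightD)+
      \<comment> \<open>Unshifted letters are at most \<open>length \<alpha>\<close> and shifted
        ones exceed it, in both components because the lengths of \<alpha> and \<alpha>'
        agree.\<close>
      then have "fst x < fst y" "snd x < snd y"
        using \<alpha>(1-3) \<beta>(1,2) by (fastforce dest: bounded_wordsD)+
      then show "?R x y \<and> ?R y x"
        by auto
    qed
  qed
  then have "Inv (map fst Z) = Inv (map snd Z)"
    by (simp add: Inv_eq_iff_sorted_wrt_zip zip_map_fst_snd)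
  moreover have "map snd Z \<in> map snd ` shuffles (zip \<alpha> \<alpha>') (zip (?s \<beta>) (?s \<beta>'))"
    using Z(1) by blast
  then have "map snd Z \<in> shifted_shuffle \<alpha>' \<beta>'"
    using \<alpha>(3) \<beta>(3) by (simp add: map_shuffles shifted_shuffle_def)
  ultimately show ?thesis
    using that[of "map snd Z"] Z(2) by simp
qed

text \<open>The two factors share no letter, so distinct interleavings give distinct words and the
  count depends on the lengths only.\<close>

lemma card_shifted_shuffle:
  assumes "\<alpha> \<in> bounded_words" "\<beta> \<in> bounded_words"
  shows "card (shifted_shuffle \<alpha> \<beta>) = (length \<alpha> + length \<beta>) choose length \<alpha>"
proof -
  have "set \<alpha> \<inter> set (map (\<lambda>x. x + length \<alpha>) \<beta>) = {}"
    using assms by (fastforce dest: bounded_wordsD)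
  then show ?thesis
    by (simp add: shifted_shuffle_def card_disjoint_shuffles)
qed

lemma all_perms_subset_bounded_words: "all_perms \<subseteq> bounded_words"
  using all_perms_subset_PF PF_subset_bounded_words by blast

lemma bij_betw_standardize:
  assumes \<alpha>: "\<alpha> \<in> bounded_words" and \<beta>: "\<beta> \<in> bounded_words"
  shows "bij_betw standardize (shifted_shuffle \<alpha> \<beta>)
    (shifted_shuffle (standardize \<alpha>) (standardize \<beta>))"
proof -
  let ?S = "shifted_shuffle \<alpha> \<beta>" and ?T = "shifted_shuffle (standardize \<alpha>) (standardize \<beta>)"
  have std: "standardize \<alpha> \<in> bounded_words" "standardize \<beta> \<in> bounded_words"
    using standardize_all_perms all_perms_subset_bounded_words by blast+
  \<comment> \<open>The words of \<open>?T\<close> are permutations, so one with the length and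
    inversion set of some word must be the standardization of that word. Both inclusions below rest
    on this.\<close>
  have fixed: "standardize \<gamma> = \<gamma>" if "\<gamma> \<in> ?T" for \<gamma>
    using that standardize_perm shifted_shuffle_all_perms standardize_all_perms by blast
  have image: "standardize ` ?S = ?T"
  proof (intro subset_antisym subsetI)
    fix \<gamma>' assume "\<gamma>' \<in> standardize ` ?S"
    then obtain \<gamma> where \<gamma>: "\<gamma> \<in> ?S" "\<gamma>' = standardize \<gamma>" by auto
    obtain \<delta> where \<delta>: "\<delta> \<in> ?T" "length \<delta> = length \<gamma>" "Inv \<delta> = Inv \<gamma>"
      using shifted_shuffle_transfer[OF \<alpha> std(1) _ _ \<beta> std(2) _ _ \<gamma>(1)]
      by (metis Inv_standardize length_standardize)
    then have "standardize \<gamma> = \<delta>"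
      using standardize_cong[of \<gamma> \<delta>] fixed[OF \<delta>(1)] by metis
    then show "\<gamma>' \<in> ?T"
      using \<delta>(1) \<gamma>(2) by simp
  next
    fix \<delta> assume \<delta>: "\<delta> \<in> ?T"
    obtain \<gamma> where \<gamma>: "\<gamma> \<in> ?S" "length \<gamma> = length \<delta>" "Inv \<gamma> = Inv \<delta>"
      using shifted_shuffle_transfer[OF std(1) \<alpha> _ _ std(2) \<beta> _ _ \<delta>]
      by (metis Inv_standardize length_standardize)
    then have "standardize \<gamma> = \<delta>"
      using standardize_cong[of \<gamma> \<delta>] fixed[OF \<delta>] by metis
    then show "\<delta> \<in> standardize ` ?S"
      using \<gamma>(1) by blast
  qed
  \<comment> \<open>Injectivity comes from counting: both sets have the same binomial cardinality.\<close>
  moreover have "card (standardize ` ?S) = card ?S"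
    unfolding image by (simp add: card_shifted_shuffle \<alpha> \<beta> std)
  then have "inj_on standardize ?S"
    by (rule eq_card_imp_inj_on[rotated]) simp
  ultimately show ?thesis
    by (simp add: bij_betw_def)
qed

text \<open>\<open>standardize\<close> is a bijection between the two sets of shuffles and preserves
  \<open>Inv\<close>. The right side depends only on the lengths and inversion sets of the
  factors.\<close>

lemma image_mset_Inv_shifted_shuffle:
  assumes "\<alpha> \<in> bounded_words" "\<beta> \<in> bounded_words"
  shows "image_mset Inv (mset_set (shifted_shuffle \<alpha> \<beta>)) =
    image_mset Inv (mset_set (shifted_shuffle (standardize \<alpha>) (standardize \<beta>)))"
proof -
  have "mset_set (shifted_shuffle (standardize \<alpha>) (standardize \<beta>)) =
      image_mset standardize (mset_set (shifted_shuffle \<alpha> \<beta>))"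
    using bij_betw_standardize[OF assms] by (simp add: bij_betw_def image_mset_mset_set)
  then show ?thesis
    by (simp add: multiset.map_comp o_def)
qed

lemma weakly_shuffle_compatible_Inv: "weakly_shuffle_compatible_PF Inv"
  unfolding weakly_shuffle_compatible_PF_def
proof (intro ballI impI)
  fix \<alpha> \<beta> \<alpha>' \<beta>'
  assume "\<alpha> \<in> PF" "\<beta> \<in> PF" "\<alpha>' \<in> PF" "\<beta>' \<in> PF" "length \<alpha> = length \<alpha>'" "length \<beta> = length \<beta>'"
    "Inv \<alpha> = Inv \<alpha>'" "Inv \<beta> = Inv \<beta>'"
  then show "image_mset Inv (mset_set (shifted_shuffle \<alpha> \<beta>)) =
      image_mset Inv (mset_set (shifted_shuffle \<alpha>' \<beta>'))"
    using image_mset_Inv_shifted_shuffle[of \<alpha> \<beta>] image_mset_Inv_shifted_shuffle[of \<alpha>' \<beta>']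
      standardize_cong[of \<alpha> \<alpha>'] standardize_cong[of \<beta> \<beta>']
    by (simp add: PF_subset_bounded_words[THEN subsetD])
qed

section \<open>The algebra of inversion set classes\<close>

lemma standardize_PF: "standardize \<alpha> \<in> PF"
  using standardize_all_perms all_perms_subset_PF by blast

lemma PF_class_Inv_standardize [simp]: "PF_class Inv (standardize \<alpha>) = PF_class Inv \<alpha>"
  by (simp add: PF_class_def)

lemma standardize_in_PF_class: "standardize \<alpha> \<in> PF_class Inv \<alpha>"
  by (simp add: PF_class_def standardize_PF)

lemma perm_in_PF_class_iff:
  "\<pi> \<in> PF_class Inv \<alpha> \<and> \<pi> \<in> all_perms \<longleftrightarrow> \<pi> = standardize \<alpha>"
proof
  assume \<pi>: "\<pi> \<in> PF_class Inv \<alpha> \<and> \<pi> \<in> all_perms"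
  then have "standardize \<pi> = standardize \<alpha>"
    by (intro standardize_cong) (auto simp: PF_class_def)
  then show "\<pi> = standardize \<alpha>"
    using \<pi> standardize_perm by simp
qed (simp add: standardize_in_PF_class standardize_all_perms)

lemma the_perm_in_PF_class: "(THE \<pi>. \<pi> \<in> PF_class Inv \<alpha> \<and> \<pi> \<in> all_perms) = standardize \<alpha>"
  by (simp add: perm_in_PF_class_iff)

text \<open>All words of a class have the same length, so choosing from \<open>all_perms\<close>, as
  the map does, agrees with choosing from permutations of the right length.\<close>

lemma perm_length_in_PF_class_iff:
  "\<pi> \<in> PF_class Inv \<alpha> \<and> \<pi> \<in> perms (length \<alpha>) \<longleftrightarrow> \<pi> = standardize \<alpha>"
  using perm_in_PF_class_iff[of \<pi> \<alpha>] by (auto simp: all_perms_iff PF_class_def standardize_perms)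

text \<open>The inverse sends a permutation to its class.\<close>

lemma bij_betw_PF_class_Inv:
  "bij_betw (\<lambda>C. THE \<pi>. \<pi> \<in> C \<and> \<pi> \<in> all_perms) (PF_class Inv ` PF) all_perms"
proof (rule bij_betw_byWitness[where f' = "PF_class Inv"])
  show "PF_class Inv ` all_perms \<subseteq> PF_class Inv ` PF"
    using all_perms_subset_PF by blast
qed (auto simp: the_perm_in_PF_class standardize_perm standardize_all_perms)

section \<open>The product of classes\<close>

definition class_product ::
  "nat list set \<Rightarrow> nat list set \<Rightarrow> nat list set \<Rightarrow>\<^sub>0 rat" where
  "class_product C D =
     (\<Sum>\<gamma> \<in> shifted_shuffle (SOME \<alpha>. \<alpha> \<in> C) (SOME \<beta>. \<beta> \<in> D). bvec (PF_class Inv \<gamma>))"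

lemma A_PF_Inv_eq:
  "A_PF Inv = basis_algebra (PF_class Inv ` PF) (PF_class Inv []) class_product"
  by (simp add: A_PF_def class_product_def[abs_def])

lemma sum_PF_class_standardize:
  assumes "\<alpha> \<in> PF" "\<beta> \<in> PF"
  shows "(\<Sum>\<gamma> \<in> shifted_shuffle \<alpha> \<beta>. bvec (PF_class Inv \<gamma>)) =
    (\<Sum>\<gamma> \<in> shifted_shuffle (standardize \<alpha>) (standardize \<beta>). bvec (PF_class Inv \<gamma>))"
  using sum.reindex_bij_betw[OF bij_betw_standardize, of \<alpha> \<beta> "\<lambda>\<gamma>. bvec (PF_class Inv \<gamma>)"]
    assms PF_subset_bounded_words by auto

text \<open>Independence of the representatives: the chosen words and the given ones have the same
  standardizations, and by \<open>sum_PF_class_standardize\<close> both sums equal the sum over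
  shuffles of these.\<close>

lemma class_product_eq:
  assumes "\<alpha> \<in> PF" "\<beta> \<in> PF"
  shows "class_product (PF_class Inv \<alpha>) (PF_class Inv \<beta>) =
    (\<Sum>\<gamma> \<in> shifted_shuffle \<alpha> \<beta>. bvec (PF_class Inv \<gamma>))"
proof -
  have rep: "(SOME \<gamma>. \<gamma> \<in> PF_class Inv \<delta>) \<in> PF"
    "standardize (SOME \<gamma>. \<gamma> \<in> PF_class Inv \<delta>) = standardize \<delta>" for \<delta>
  proof -
    \<comment> \<open>The choice is made from a nonempty set, as the class contains
      \<open>standardize \<delta>\<close>.\<close>
    have "(SOME \<gamma>. \<gamma> \<in> PF_class Inv \<delta>) \<in> PF_class Inv \<delta>"
      using standardize_in_PF_class by (rule someI)
    then show "(SOME \<gamma>. \<gamma> \<in> PF_class Inv \<delta>) \<in> PF"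
      "standardize (SOME \<gamma>. \<gamma> \<in> PF_class Inv \<delta>) = standardize \<delta>"
      by (auto simp: PF_class_def intro: standardize_cong)
  qed
  show ?thesis
    using sum_PF_class_standardize[OF assms] sum_PF_class_standardize[OF rep(1) rep(1), of \<alpha> \<beta>]
    by (simp add: class_product_def rep(2))
qed

lemma Nil_PF: "[] \<in> PF"
  by (simp add: PF_def)

lemma assoc_algebra_A_PF_Inv: "assoc_algebra rat_field (A_PF Inv)"
  unfolding A_PF_Inv_eq
proof (rule assoc_algebra_basis_algebra)
  show "PF_class Inv [] \<in> PF_class Inv ` PF"
    using Nil_PF by blast
next
  fix C D assume "C \<in> PF_class Inv ` PF" "D \<in> PF_class Inv ` PF"
  then obtain \<alpha> \<beta> where *: "\<alpha> \<in> PF" "\<beta> \<in> PF" "C = PF_class Inv \<alpha>" "D = PF_class Inv \<beta>"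
    by auto
  have "PF_class Inv ` shifted_shuffle \<alpha> \<beta> \<subseteq> PF_class Inv ` PF"
    using shifted_shuffle_PF[OF *(1,2)] by blast
  then show "Poly_Mapping.keys (class_product C D) \<subseteq> PF_class Inv ` PF"
    by (simp add: * class_product_eq keys_sum_bvec)
next
  fix C D E
  assume "C \<in> PF_class Inv ` PF" "D \<in> PF_class Inv ` PF" "E \<in> PF_class Inv ` PF"
  then obtain \<alpha> \<beta> \<gamma> where *: "\<alpha> \<in> PF" "\<beta> \<in> PF" "\<gamma> \<in> PF"
    and CDE: "C = PF_class Inv \<alpha>" "D = PF_class Inv \<beta>" "E = PF_class Inv \<gamma>"
    by auto
  have "\<alpha> \<in> bounded_words" "\<beta> \<in> bounded_words" "\<gamma> \<in> bounded_words"
    using * PF_subset_bounded_words by auto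
  \<comment> \<open>Intermediate shuffles are again parking functions, so
    \<open>class_product_eq\<close> also evaluates the outer products and reduces the claim to
    words.\<close>
  from sum_shifted_shuffle_assoc[OF this, of "\<lambda>\<sigma>. bvec (PF_class Inv \<sigma>)"]
  show "lin_extend (\<lambda>F. class_product F E) (class_product C D) =
      lin_extend (class_product C) (class_product D E)"
    using * shifted_shuffle_PF[OF *(1,2)] shifted_shuffle_PF[OF *(2,3)]
    by (simp add: CDE class_product_eq lin_extend_sum)
next
  fix C assume "C \<in> PF_class Inv ` PF"
  then obtain \<alpha> where "\<alpha> \<in> PF" "C = PF_class Inv \<alpha>"
    by auto
  then show "class_product (PF_class Inv []) C = bvec C" "class_product C (PF_class Inv []) = bvec C"
    by (simp_all add: class_product_eq Nil_PF)
qed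

section \<open>The algebra FQSym and the isomorphism\<close>

definition perm_product :: "nat list \<Rightarrow> nat list \<Rightarrow> nat list \<Rightarrow>\<^sub>0 rat" where
  "perm_product \<tau> \<theta> = (\<Sum>\<pi> \<in> shifted_shuffle \<tau> \<theta>. bvec \<pi>)"

lemma FQSym_eq: "FQSym = basis_algebra all_perms [] perm_product"
  by (simp add: FQSym_def perm_product_def[abs_def])

lemma assoc_algebra_FQSym: "assoc_algebra rat_field FQSym"
  unfolding FQSym_eq
proof (rule assoc_algebra_basis_algebra)
  show "[] \<in> all_perms"
    by (auto simp: all_perms_def perms_iff)
next
  fix \<tau> \<theta> assume "\<tau> \<in> all_perms" "\<theta> \<in> all_perms"
  then have "(\<lambda>\<pi>. \<pi>) ` shifted_shuffle \<tau> \<theta> \<subseteq> all_perms"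
    using shifted_shuffle_all_perms[of \<tau> \<theta>] by blast
  then show "Poly_Mapping.keys (perm_product \<tau> \<theta>) \<subseteq> all_perms"
    unfolding perm_product_def by (rule keys_sum_bvec)
next
  fix \<tau> \<theta> \<rho> assume "\<tau> \<in> all_perms" "\<theta> \<in> all_perms" "\<rho> \<in> all_perms"
  then have "\<tau> \<in> bounded_words" "\<theta> \<in> bounded_words" "\<rho> \<in> bounded_words"
    using all_perms_subset_bounded_words by auto
  from sum_shifted_shuffle_assoc[OF this, of bvec]
  show "lin_extend (\<lambda>\<sigma>. perm_product \<sigma> \<rho>) (perm_product \<tau> \<theta>) =
      lin_extend (perm_product \<tau>) (perm_product \<theta> \<rho>)"
    by (simp add: perm_product_def lin_extend_sum)
qed (simp_all add: perm_product_def)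

lemma is_algebra_iso_Inv_to_FQSym: "is_algebra_iso rat_field (A_PF Inv) FQSym Inv_to_FQSym"
proof -
  let ?h = "\<lambda>C. THE \<pi>. \<pi> \<in> C \<and> \<pi> \<in> all_perms"
  have "lin_extend (\<lambda>C. bvec (?h C)) (class_product C D) = perm_product (?h C) (?h D)"
    if "C \<in> PF_class Inv ` PF" "D \<in> PF_class Inv ` PF" for C D
  proof -
    obtain \<alpha> \<beta> where *: "\<alpha> \<in> PF" "\<beta> \<in> PF" "C = PF_class Inv \<alpha>" "D = PF_class Inv \<beta>"
      using \<open>C \<in> _\<close> \<open>D \<in> _\<close> by auto
    then have "\<alpha> \<in> bounded_words" "\<beta> \<in> bounded_words"
      using PF_subset_bounded_words by auto
    \<comment> \<open>The map replaces the class of each shuffle by the standardization of that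
      shuffle; reindexing turns these into the shuffles of the standardized factors.\<close>
    from sum.reindex_bij_betw[OF bij_betw_standardize[OF this], of bvec] show ?thesis
      by (simp add: * class_product_eq perm_product_def lin_extend_sum the_perm_in_PF_class)
  qed
  moreover have "?h (PF_class Inv []) = []"
    by (simp add: the_perm_in_PF_class standardize_def)
  ultimately show ?thesis
    unfolding Inv_to_FQSym_def
    using assoc_algebra_A_PF_Inv assoc_algebra_FQSym bij_betw_PF_class_Inv
    unfolding A_PF_Inv_eq FQSym_eq
    by (intro is_algebra_iso_lin_extend) auto
qed

theorem theorem4p6:
  shows "weakly_shuffle_compatible_PF Inv
    \<and> (\<forall>\<alpha> \<in> PF. \<forall>\<beta> \<in> PF.
         bvec (PF_class Inv \<alpha>) \<otimes>\<^bsub>A_PF Inv\<^esub> bvec (PF_class Inv \<beta>)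
           = (\<Sum>\<gamma> \<in> shifted_shuffle \<alpha> \<beta>. bvec (PF_class Inv \<gamma>)))
    \<and> (\<forall>\<alpha> \<in> PF. \<exists>!\<pi>. \<pi> \<in> PF_class Inv \<alpha> \<and> \<pi> \<in> perms (length \<alpha>))
    \<and> (\<forall>\<alpha> \<in> PF. \<forall>\<pi> \<in> PF_class Inv \<alpha> \<inter> perms (length \<alpha>).
         Inv_to_FQSym (bvec (PF_class Inv \<alpha>)) = bvec \<pi>)
    \<and> is_algebra_iso rat_field (A_PF Inv) FQSym Inv_to_FQSym"
proof (intro conjI ballI)
  fix \<alpha> \<beta> assume "\<alpha> \<in> PF" "\<beta> \<in> PF"
  then show "bvec (PF_class Inv \<alpha>) \<otimes>\<^bsub>A_PF Inv\<^esub> bvec (PF_class Inv \<beta>)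
      = (\<Sum>\<gamma> \<in> shifted_shuffle \<alpha> \<beta>. bvec (PF_class Inv \<gamma>))"
    by (simp add: A_PF_Inv_eq basis_algebra_def class_product_eq)
next
  fix \<alpha> assume "\<alpha> \<in> PF"
  show "\<exists>!\<pi>. \<pi> \<in> PF_class Inv \<alpha> \<and> \<pi> \<in> perms (length \<alpha>)"
    by (simp add: perm_length_in_PF_class_iff)
next
  fix \<alpha> \<pi> assume "\<pi> \<in> PF_class Inv \<alpha> \<inter> perms (length \<alpha>)"
  then show "Inv_to_FQSym (bvec (PF_class Inv \<alpha>)) = bvec \<pi>"
    using perm_length_in_PF_class_iff[of \<pi> \<alpha>]
    by (simp add: Inv_to_FQSym_def the_perm_in_PF_class)
qed (rule weakly_shuffle_compatible_Inv is_algebra_iso_Inv_to_FQSym)+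

end
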